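(* Let $1\le k<n$ be integers and let $x_1,\dots,x_n$ be positive integers with $\sigma_k(x_1,\dots,x_n)=\sigma_n(x_1,\dots,x_n)$. Then $$\sigma_n(x_1,\dots,x_n)\ge \binom{n}{k}^{\frac{n}{n-k}}.$$ Equality holds if and only if either $k=n-1$ and $x_1=\dots=x_n=n$, or $k=n-2$, $\binom{n}{2}$ is a perfect square and $x_1=\dots=x_n=\sqrt{\binom{n}{2}}$.
   Context: For $1\le j\le n$, $\sigma_j(x_1,\dots,x_n)=\sum_{1\le i_1<\dots<i_j\le n}x_{i_1}\cdots x_{i_j}$ is the $j$th elementary symmetric polynomial; in particular $\sigma_n(x_1,\dots,x_n)=x_1\cdots x_n$. *)

theory Defs
  imports Complex_Main "HOL-Computational_Algebra.Nth_Powers"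
begin

(* The strictly increasing index tuples i_1 < ... < i_j in {1..n} are encoded as the
   j-element subsets of {1..n}; the values of x outside {1..n} are irrelevant. *)
definition sigma :: "nat \<Rightarrow> nat \<Rightarrow> (nat \<Rightarrow> 'a::comm_semiring_1) \<Rightarrow> 'a" where
  "sigma j n x = (\<Sum>I | I \<subseteq> {1..n} \<and> card I = j. \<Prod>i\<in>I. x i)"

lemma sigma_top: "sigma n n x = (\<Prod>i=1..n. x i)"
proof -
  have "{I. I \<subseteq> {1..n} \<and> card I = n} = {{1..n}}"
    using card_subset_eq[of "{1..n}"] by auto
  then show ?thesis
    by (simp add: sigma_def)
qed

end

theory Submission
  imports Defs
begin

text \<open>
  By the inequality of the means for the products over \<open>k\<close>-subsets, equality forces all
  \<open>x\<^sub>i\<close> to equal some \<open>c\<close>, and then \<open>n choose l = c ^ l\<close> for \<open>l = n - k\<close>. The point is that this is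
  impossible for \<open>l \<ge> 3\<close>. If \<open>n < 2 * l\<close>, then \<open>c < 4\<close> is prime, but a prime power dividing
  \<open>n choose l\<close> is at most \<open>n\<close>. If \<open>n \<ge> 2 * l\<close>, follow Erdos: write the \<open>l\<close> factors \<open>n - l + i\<close> as
  \<open>a\<^sub>i * m\<^sub>i ^ l\<close> with \<open>a\<^sub>i\<close> free of \<open>l\<close>-th powers. Since the exponent equals the number of factors, the
  \<open>a\<^sub>i\<close> are distinct without any appeal to Sylvester's theorem, and they are a permutation of \<open>1, \<dots>, l\<close>.
  For \<open>l \<ge> 4\<close> the factors with \<open>a\<^sub>i = 1, 2, 4\<close> contradict each other. For \<open>l = 3\<close> one is led to
  \<open>x\<^sup>3 + y\<^sup>3 = 2 * z\<^sup>3\<close>, which by Euler's descent has only trivial solutions.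
\<close>

subsection \<open>Cubes of the form \<open>p\<^sup>2 + 3 * q\<^sup>2\<close>\<close>

text \<open>Thue's lemma. With \<open>m\<close> the integer square root of \<open>s\<close>, there
  are \<open>(m + 1) ^ 2 > s\<close> pairs with entries in \<open>0..m\<close>, so two of them give
  the same residue of \<open>x - r * y\<close>; their difference is the solution.\<close>

lemma small_congruence_solution:
  fixes r s :: int
  assumes "s > 0"
  obtains a b where "(a, b) \<noteq> (0, 0)" "a\<^sup>2 \<le> s" "b\<^sup>2 \<le> s" "s dvd a - r * b"
proof -
  obtain m where m: "m ^ 2 \<le> nat s" "nat s < (m + 1) ^ 2"
    using nth_root_nat_power_le[of 2 "nat s"] nth_root_nat_ge[of 2 "nth_root_nat 2 (nat s) + 1" "nat s"]
    by (metis Suc_eq_plus1 Suc_n_not_le_n linorder_not_le zero_less_numeral)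
  have m1: "(int m)\<^sup>2 \<le> s"
    using m(1) assms by (metis nat_le_eq_zle nat_int of_nat_power linorder_not_le order.strict_iff_not le_nat_iff)
  define f where "f = (\<lambda>(x, y). (x - r * y) mod s)"
  let ?D = "{0..int m} \<times> {0..int m}"
  have "f ` ?D \<subseteq> {0..<s}"
    using assms by (auto simp: f_def)
  then have "card (f ` ?D) \<le> nat s"
    by (metis card_atLeastLessThan_int card_mono diff_zero finite_atLeastLessThan_int)
  also have "\<dots> < card ?D"
    using m(2) by (simp add: card_cartesian_product power2_eq_square nat_add_distrib)
  finally have "\<not> inj_on f ?D"
    using card_image by fastforce
  then obtain x y x' y' where *: "(x, y) \<in> ?D" "(x', y') \<in> ?D" "(x, y) \<noteq> (x', y')"
      "f (x, y) = f (x', y')"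
    unfolding inj_on_def by fast
  have sq: "(u - v)\<^sup>2 \<le> s" if "u \<in> {0..int m}" "v \<in> {0..int m}" for u v
  proof -
    have "\<bar>u - v\<bar> \<le> \<bar>int m\<bar>" using that by auto
    then show ?thesis using m1 abs_le_square_iff order_trans by blast
  qed
  have "s dvd (x - x') - r * (y - y')"
    using *(4) by (simp add: f_def mod_eq_dvd_iff algebra_simps)
  then show thesis
    using that[of "x - x'" "y - y'"] sq[of x x'] sq[of y y'] *(1-3) by auto
qed

text \<open>Thue's lemma gives a multiple \<open>a ^ 2 + 3 * b ^ 2\<close> of \<open>s\<close> that
  is at most \<open>4 * s\<close>. The cofactor 2 fails modulo 4, the cofactor 3 is removed by
  dividing by \<open>sqrt (- 3)\<close>, and the cofactor 4 would force
  \<open>s = 1\<close>.\<close>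

lemma norm_form_root:
  fixes r s :: int
  assumes "s > 1" "odd s" "\<not> 3 dvd s" "s dvd r\<^sup>2 + 3"
  obtains a b where "a\<^sup>2 + 3 * b\<^sup>2 = s" "s dvd a - r * b"
proof -
  obtain a b where ab: "(a, b) \<noteq> (0, 0)" "a\<^sup>2 \<le> s" "b\<^sup>2 \<le> s" "s dvd a - r * b"
    using small_congruence_solution[of s r] assms(1) by auto
  have "a\<^sup>2 + 3 * b\<^sup>2 = (a - r * b) * (a + r * b) + b\<^sup>2 * (r\<^sup>2 + 3)"
    by (simp add: power2_eq_square algebra_simps)
  then have "s dvd a\<^sup>2 + 3 * b\<^sup>2"
    using ab(4) assms(4) by (metis dvd_add dvd_mult dvd_mult2)
  then obtain c where c: "a\<^sup>2 + 3 * b\<^sup>2 = s * c" by auto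
  have pos: "a\<^sup>2 + 3 * b\<^sup>2 > 0"
    using ab(1) by (smt (verit) Pair_inject zero_less_power2 zero_le_power2)
  have "c > 0" using pos c assms(1) by (metis zero_less_mult_pos order.strict_trans zero_less_one)
  moreover have "s * c \<le> s * 4" using ab c by simp
  then have "c \<le> 4" using assms(1) by simp
  ultimately consider "c = 1" | "c = 2" | "c = 3" | "c = 4" by linarith
  then show thesis
  proof cases
    case 1
    then show ?thesis using that[of a b] ab c by simp
  next
    case 2
    have "(a\<^sup>2 + 3 * b\<^sup>2) mod 4 \<in> {0, 1, 3}"
    proof -
      have "u\<^sup>2 mod 4 \<in> {0, 1}" for u :: int
      proof (cases "even u")
        case True
        then show ?thesis by (auto elim!: evenE simp: power2_eq_square)
      next
        case False
        then obtain v where "u = 2 * v + 1" by (auto elim!: oddE)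
        then have "u\<^sup>2 = 1 + 4 * (v\<^sup>2 + v)" by (simp add: power2_eq_square algebra_simps)
        then have "u\<^sup>2 mod 4 = 1" by presburger
        then show ?thesis by simp
      qed
      then have "a\<^sup>2 mod 4 \<in> {0, 1}" "b\<^sup>2 mod 4 \<in> {0, 1}" by blast+
      moreover have "(a\<^sup>2 + 3 * b\<^sup>2) mod 4 = (a\<^sup>2 mod 4 + 3 * (b\<^sup>2 mod 4)) mod 4"
        by presburger
      ultimately show ?thesis by auto
    qed
    moreover have "s * 2 mod 4 = 2"
      using assms(2) by (auto elim!: oddE)
    ultimately show ?thesis using c 2 by auto
  next
    case 3
    then have "3 dvd a\<^sup>2" using c by (metis dvd_add_triv_right_iff dvd_triv_left dvd_triv_right dvd_add_left_iff)
    then have "3 dvd a" by (simp add: prime_dvd_power_iff)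
    then obtain a' where a': "a = 3 * a'" by auto
    \<comment> \<open>Dividing \<open>3 * a' + b * sqrt (- 3)\<close> by \<open>sqrt (- 3)\<close>
      gives \<open>b - a' * sqrt (- 3)\<close>, hence the new pair \<open>(b, - a')\<close>.\<close>
    have "3 * a'\<^sup>2 + b\<^sup>2 = s" using c 3 a' by (simp add: power2_eq_square)
    moreover have "s dvd 3 * (b + r * a')"
    proof -
      have "3 * (b + r * a') = b * (r\<^sup>2 + 3) + r * (a - r * b)"
        by (simp add: a' power2_eq_square algebra_simps)
      then show ?thesis using ab(4) assms(4) by (metis dvd_add dvd_mult)
    qed
    moreover have "coprime s 3"
      using assms(3) prime_imp_coprime[of "3::int" s] by (simp add: coprime_commute)
    ultimately have "b\<^sup>2 + 3 * (- a')\<^sup>2 = s" "s dvd b + r * a'"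
      by (simp, metis coprime_dvd_mult_right_iff)
    then show ?thesis
      using that[of b "- a'"] by simp
  next
    case 4
    then have "a\<^sup>2 = s" "b\<^sup>2 = s" using ab c by auto
    then have "a\<^sup>2 = b\<^sup>2" by simp
    then have "a = 1 * b \<or> a = (- 1) * b" by (simp add: power2_eq_iff)
    then obtain e where e: "a = e * b" "e\<^sup>2 = 1" by (metis one_power2 power2_minus)
    have b0: "b \<noteq> 0" using \<open>b\<^sup>2 = s\<close> assms(1) by auto
    \<comment> \<open>As \<open>s = b * b\<close>, the congruence reduces to
      \<open>b dvd e - r\<close>. With \<open>b dvd r ^ 2 + 3\<close> this gives
      \<open>b dvd e ^ 2 + 3 = 4\<close>, and an odd divisor of 4 is a unit.\<close>
    have "b * b dvd b * (e - r)"
      using ab(4) \<open>b\<^sup>2 = s\<close> by (simp add: e(1) power2_eq_square algebra_simps)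
    then have d: "b dvd e - r" using b0 by simp
    have "b dvd r\<^sup>2 + 3" using assms(4) \<open>b\<^sup>2 = s\<close> by (metis dvd_trans dvd_triv_left power2_eq_square)
    moreover have "4 = (r\<^sup>2 + 3) + (e - r) * (e + r)"
      using e(2) by (simp add: power2_eq_square algebra_simps)
    ultimately have "b dvd 2 ^ 2" using d by (metis dvd_add dvd_mult2 numeral_Bit0 power2_eq_square mult_2 numeral_times_numeral one_add_one)
    moreover have "odd b" using \<open>b\<^sup>2 = s\<close> assms(2) by auto
    then have "coprime b (2 ^ 2)" by (simp only: coprime_power_right_iff) simp
    ultimately have "is_unit b" by (metis coprime_common_divisor dvd_refl)
    then have "s = 1" using \<open>b\<^sup>2 = s\<close> by (metis one_power2 power2_abs zdvd1_eq)
    then show ?thesis using assms(1) by simp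
  qed
qed

text \<open>
  Unique factorisation in the Eisenstein integers is avoided: \<open>r = p / q\<close> is a square root of \<open>- 3\<close>
  modulo \<open>s ^ 3\<close>, and it yields \<open>s = a\<^sup>2 + 3 * b\<^sup>2\<close> with \<open>a / b = r\<close> modulo \<open>s\<close>. The cube \<open>A + B * sqrt (- 3)\<close>
  of \<open>a + b * sqrt (- 3)\<close> then satisfies \<open>A / B = r\<close> modulo \<open>s ^ 3\<close>, and since it has the same norm as
  \<open>p + q * sqrt (- 3)\<close>, the determinant \<open>p * B - A * q\<close> is too small to be a nonzero multiple of \<open>s ^ 3\<close>.
\<close>

lemma cube_norm_form:
  fixes p q s :: int
  assumes eq: "p\<^sup>2 + 3 * q\<^sup>2 = s ^ 3" and cop: "coprime p q" and "odd s"
  obtains a b where "p = a ^ 3 - 9 * a * b\<^sup>2" "q = 3 * a\<^sup>2 * b - 3 * b ^ 3" "s = a\<^sup>2 + 3 * b\<^sup>2"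
proof (cases "s = 1")
  case True
  have "q = 0"
  proof (rule ccontr)
    assume "q \<noteq> 0"
    then have "q\<^sup>2 > 0" by simp
    then show False using eq True by (smt (verit) one_power2 power_one zero_le_power2)
  qed
  then have "p\<^sup>2 = 1" using eq True by simp
  then have "p = 1 \<or> p = -1" by (simp add: power2_eq_1_iff)
  then show ?thesis using that[of p 0] True \<open>q = 0\<close> by auto
next
  case False
  have "p\<^sup>2 + 3 * q\<^sup>2 \<ge> 0" by simp
  then have "s \<ge> 0" using eq by (simp add: zero_le_power_eq)
  then have s1: "s > 1" using False \<open>odd s\<close> by (cases "s = 0") auto
  have cqs: "coprime q s"
  proof (rule ccontr)
    assume "\<not> coprime q s"
    then obtain t where t: "prime t" "t dvd q" "t dvd s"
      using prime_divisor_exists[of "gcd q s"] s1 by (auto simp: coprime_iff_gcd_eq_1)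
    have "t dvd p\<^sup>2"
      using t(2,3) eq by (metis dvd_add_left_iff dvd_mult dvd_power zero_less_numeral dvd_trans)
    then have "t dvd p" using t(1) prime_dvd_power by blast
    then show False using t cop by (metis coprime_common_divisor not_prime_unit)
  qed
  have n3: "\<not> 3 dvd s"
  proof
    assume 3: "3 dvd s"
    then have "3 dvd s ^ 3" by (simp add: dvd_trans[OF _ dvd_power])
    then have "3 dvd p\<^sup>2" using eq by (metis dvd_add_left_iff dvd_triv_left)
    then have "3 dvd p" by (simp add: prime_dvd_power_iff)
    then have "3\<^sup>2 dvd p\<^sup>2" by (metis dvd_power_same)
    moreover have "(3::int)\<^sup>2 dvd s ^ 3"
      using dvd_power_same[OF 3, of 3] by (auto elim!: dvdE)
    ultimately have "3\<^sup>2 dvd 3 * q\<^sup>2" using eq by (metis dvd_add_right_iff)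
    then have "3 * 3 dvd 3 * q\<^sup>2" by simp
    then have "3 dvd q\<^sup>2" by (simp only: dvd_mult_cancel_left) simp
    then have "3 dvd q" by (simp add: prime_dvd_power_iff)
    then show False using \<open>3 dvd p\<close> cop by (auto dest: coprime_common_divisor[of p q 3])
  qed
  have "coprime q (s ^ 3)" using cqs by simp
  then obtain q' c' where "q * q' + s ^ 3 * c' = 1"
    using bezout_int[of q "s ^ 3"] by (auto simp: coprime_iff_gcd_eq_1 mult.commute)
  then have "q * q' - 1 = s ^ 3 * (- c')" by simp
  then have q': "s ^ 3 dvd q * q' - 1" by (metis dvd_triv_left)
  define r where "r = p * q'"
  have "r * q - p = p * (q * q' - 1)" by (simp add: r_def algebra_simps)
  then have pr: "s ^ 3 dvd r * q - p" using q' by simp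
  have "q\<^sup>2 * (r\<^sup>2 + 3) = (r * q - p) * (r * q + p) + s ^ 3"
    by (simp flip: eq add: power2_eq_square algebra_simps)
  then have "s ^ 3 dvd q\<^sup>2 * (r\<^sup>2 + 3)" using pr by (metis dvd_add dvd_mult2 dvd_refl)
  moreover have "coprime (s ^ 3) (q\<^sup>2)" using cqs by (simp add: coprime_commute)
  ultimately have r3: "s ^ 3 dvd r\<^sup>2 + 3" by (simp add: coprime_dvd_mult_right_iff)
  then have "s dvd r\<^sup>2 + 3" by (meson dvd_power dvd_trans zero_less_numeral)
  then obtain a b where ab: "a\<^sup>2 + 3 * b\<^sup>2 = s" "s dvd a - r * b"
    using norm_form_root[OF s1 \<open>odd s\<close> n3] by blast
  define A where "A = a ^ 3 - 9 * a * b\<^sup>2"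
  define B where "B = 3 * a\<^sup>2 * b - 3 * b ^ 3"
  have AB: "A\<^sup>2 + 3 * B\<^sup>2 = s ^ 3"
    unfolding ab(1)[symmetric] A_def B_def by algebra
  \<comment> \<open>This is the cube of \<open>a + b * sqrt (- 3)\<close> with
    \<open>sqrt (- 3)\<close> replaced by \<open>- r\<close>, up to a multiple of
    \<open>r ^ 2 + 3\<close>.\<close>
  have "A - r * B = (a - r * b) ^ 3 + (r\<^sup>2 + 3) * (r * b ^ 3 - 3 * a * b\<^sup>2)"
    unfolding A_def B_def by algebra
  then have "s ^ 3 dvd A - r * B"
    using dvd_power_same[OF ab(2), of 3] r3 by (metis dvd_add dvd_mult2)
  moreover have "p * B - A * q = - (B * (r * q - p)) - q * (A - r * B)"
    by (simp add: algebra_simps)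
  ultimately have dvd: "s ^ 3 dvd p * B - A * q"
    using pr by (metis dvd_diff dvd_minus_iff dvd_mult)
  \<comment> \<open>The left side is the norm of \<open>p + q * sqrt (- 3)\<close> times the
    conjugate of \<open>A + B * sqrt (- 3)\<close>.\<close>
  have norm: "(p * A + 3 * q * B)\<^sup>2 + 3 * (p * B - A * q)\<^sup>2 = (s ^ 3)\<^sup>2"
  proof -
    have "(p * A + 3 * q * B)\<^sup>2 + 3 * (p * B - A * q)\<^sup>2 = (p\<^sup>2 + 3 * q\<^sup>2) * (A\<^sup>2 + 3 * B\<^sup>2)"
      by algebra
    then show ?thesis by (simp only: eq AB power2_eq_square[of "s ^ 3"])
  qed
  have z: "p * B - A * q = 0"
  proof (rule ccontr)
    assume nz: "p * B - A * q \<noteq> 0"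
    then have "\<bar>s ^ 3\<bar> \<le> \<bar>p * B - A * q\<bar>" using dvd by (simp add: dvd_imp_le_int)
    then have "(s ^ 3)\<^sup>2 \<le> (p * B - A * q)\<^sup>2" by (simp only: abs_le_square_iff)
    moreover have "(p * B - A * q)\<^sup>2 > 0" using nz by simp
    moreover have "(p * A + 3 * q * B)\<^sup>2 \<ge> 0" by simp
    ultimately show False using norm by linarith
  qed
  have "B\<^sup>2 * s ^ 3 = q\<^sup>2 * s ^ 3"
  proof -
    have "B\<^sup>2 * (p\<^sup>2 + 3 * q\<^sup>2) - q\<^sup>2 * (A\<^sup>2 + 3 * B\<^sup>2) = (p * B - A * q) * (p * B + A * q)"
      by (simp add: power2_eq_square algebra_simps)
    then show ?thesis using z by (simp add: eq AB)
  qed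
  then have "B\<^sup>2 = q\<^sup>2" using s1 by simp
  then have Bq: "B = q \<or> B = - q" by (simp add: power2_eq_iff)
  have A2: "A\<^sup>2 = p\<^sup>2" using AB eq \<open>B\<^sup>2 = q\<^sup>2\<close> by simp
  \<comment> \<open>Proportional pairs of equal norm agree up to a common sign.\<close>
  have "(A = p \<and> B = q) \<or> (A = - p \<and> B = - q)"
  proof (cases "q = 0")
    case True
    then show ?thesis using Bq A2 by (auto simp: power2_eq_iff)
  next
    case False
    from Bq show ?thesis
    proof
      assume "B = q"
      then have "(p - A) * q = 0" using z by (simp add: algebra_simps)
      then show ?thesis using False \<open>B = q\<close> by simp
    next
      assume "B = - q"
      then have "(p + A) * q = 0" using z by (simp add: algebra_simps)
      then have "A = - p" using False by simp
      then show ?thesis using \<open>B = - q\<close> by simp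
    qed
  qed
  then show ?thesis
  proof
    assume "A = p \<and> B = q"
    then show ?thesis using that[of a b] ab(1) by (simp add: A_def B_def)
  next
    assume "A = - p \<and> B = - q"
    \<comment> \<open>Cubing is odd, so the sign is absorbed by replacing \<open>(a, b)\<close> with
      \<open>(- a, - b)\<close>.\<close>
    then have "p = - A" "q = - B" by auto
    then show ?thesis using that[of "- a" "- b"] ab(1) by (simp add: A_def B_def)
  qed
qed

subsection \<open>The equation \<open>x\<^sup>3 + y\<^sup>3 = 2 * z\<^sup>3\<close>\<close>

lemma coprime_dvd_add:
  fixes a b c :: int
  assumes "coprime a c" "a dvd b"
  shows "coprime a (b + c)"
proof (rule coprimeI)
  fix d assume "d dvd a" "d dvd b + c"
  then have "d dvd c" using assms(2) by (metis dvd_add_right_iff dvd_trans)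
  then show "is_unit d" using assms(1) \<open>d dvd a\<close> coprime_common_divisor by blast
qed

text \<open>Passing to absolute values reduces this to natural numbers; signs are harmless because
  the exponent is odd.\<close>

lemma coprime_product_cube:
  fixes a b z :: int
  assumes "coprime a b" "a * b = z ^ 3"
  obtains c d where "a = c ^ 3" "b = d ^ 3"
proof -
  have cube: "\<exists>c. a = c ^ 3" if "coprime a b" "a * b = z ^ 3" for a b z :: int
  proof -
    have "nat \<bar>a\<bar> * nat \<bar>b\<bar> = nat \<bar>z\<bar> ^ 3"
      using that(2) by (metis abs_mult nat_abs_mult_distrib nat_power_eq power_abs abs_ge_zero)
    moreover have "coprime (nat \<bar>a\<bar>) (nat \<bar>b\<bar>)"
      using that(1) by simp
    ultimately have "is_nth_power 3 (nat \<bar>a\<bar>)"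
      by (metis is_nth_power_mult_coprime_nat_iff is_nth_power_nth_power)
    then obtain c where "nat \<bar>a\<bar> = c ^ 3" by (auto elim: is_nth_powerE)
    then have "\<bar>a\<bar> = int c ^ 3" by (metis abs_ge_zero int_nat_eq of_nat_power)
    then have "a = int c ^ 3 \<or> a = (- int c) ^ 3" by auto
    then show ?thesis by blast
  qed
  show thesis
    using that cube[OF assms] cube[of b a z] assms by (metis coprime_commute mult.commute)
qed

text \<open>Euler's descent on \<open>z\<close>. With \<open>x = p + q\<close> and
  \<open>y = p - q\<close> the equation reads \<open>p * (p ^ 2 + 3 * q ^ 2) = z ^ 3\<close>. Once
  powers of 3 are removed, the factors are coprime cubes, and \<open>cube_norm_form\<close> splits
  the first one into three coprime cubes in arithmetic progression, up to sign, which is a smaller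
  solution.\<close>

lemma sum_of_cubes_eq_twice_cube:
  fixes x y z :: int
  assumes "x ^ 3 + y ^ 3 = 2 * z ^ 3" "coprime x y" "z \<noteq> 0"
  shows "x = y"
  using assms
proof (induction "nat \<bar>z\<bar>" arbitrary: x y z rule: less_induct)
  case less
  show ?case
  proof (rule ccontr)
    assume "x \<noteq> y"
    have "even (x ^ 3 + y ^ 3)" using less.prems(1) by simp
    then have par: "even (x + y)" by simp
    define p q where "p = (x + y) div 2" and "q = (x - y) div 2"
    have xy: "x = p + q" "y = p - q" using par unfolding p_def q_def by presburger+
    have "2 * (p * (p\<^sup>2 + 3 * q\<^sup>2)) = x ^ 3 + y ^ 3" unfolding xy by algebra
    then have pz: "p * (p\<^sup>2 + 3 * q\<^sup>2) = z ^ 3" using less.prems(1) by simp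
    have cpq: "coprime p q"
      using less.prems(2) unfolding xy
      by (meson coprime_common_divisor coprimeI dvd_add dvd_diff)
    have "\<not> (2 dvd p + q \<and> 2 dvd p - q)"
      using less.prems(2) coprime_common_divisor[of x y 2] unfolding xy by auto
    then have odd: "odd (p + q)" by auto
    have "q \<noteq> 0" using \<open>x \<noteq> y\<close> xy by auto
    have "p \<noteq> 0" using pz less.prems(3) by auto
    have "p\<^sup>2 > 0" "q\<^sup>2 > 0" using \<open>p \<noteq> 0\<close> \<open>q \<noteq> 0\<close> by auto
    then have "\<bar>p\<^sup>2 + 3 * q\<^sup>2\<bar> > 1" by linarith
    then have "\<bar>p\<bar> * 1 < \<bar>p\<bar> * \<bar>p\<^sup>2 + 3 * q\<^sup>2\<bar>"
      using \<open>p \<noteq> 0\<close> by (intro mult_strict_left_mono) auto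
    then have p_less: "\<bar>p\<bar> < \<bar>z\<bar> ^ 3" by (metis abs_mult mult.right_neutral power_abs pz)
    \<comment> \<open>This drives the descent: \<open>q\<close> being nonzero makes \<open>p\<close>
      smaller than \<open>z ^ 3\<close> in absolute value, so every \<open>Z\<close> with
      \<open>Z ^ 3 dvd p\<close> is smaller than \<open>z\<close>.\<close>
    have smaller: "nat \<bar>Z\<bar> < nat \<bar>z\<bar>" if "Z ^ 3 dvd p" for Z
    proof -
      have "\<bar>Z\<bar> ^ 3 \<le> \<bar>p\<bar>" using dvd_imp_le_int[OF \<open>p \<noteq> 0\<close> that] by (simp add: power_abs)
      then have "\<bar>Z\<bar> ^ 3 < \<bar>z\<bar> ^ 3" using p_less by linarith
      then have "\<bar>Z\<bar> < \<bar>z\<bar>" by (rule power_less_imp_less_base) simp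
      then show ?thesis by simp
    qed
    show False
    proof (cases "3 dvd p")
      case False
      then have p3: "coprime p 3" using prime_imp_coprime[of "3::int" p] by (simp add: coprime_commute)
      have "coprime p (3 * q\<^sup>2)" using p3 cpq by simp
      then have "coprime p (p\<^sup>2 + 3 * q\<^sup>2)"
        by (rule coprime_dvd_add) simp
      then obtain r s where rs: "p = r ^ 3" "p\<^sup>2 + 3 * q\<^sup>2 = s ^ 3"
        using pz coprime_product_cube by blast
      have "odd (p\<^sup>2 + 3 * q\<^sup>2)" using odd by simp
      then have "odd s" using rs(2) by simp
      then obtain a b where ab: "p = a ^ 3 - 9 * a * b\<^sup>2" "q = 3 * a\<^sup>2 * b - 3 * b ^ 3"
          "s = a\<^sup>2 + 3 * b\<^sup>2"
        using cube_norm_form[OF rs(2) cpq] by blast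
      have cab: "coprime a b"
      proof (rule coprimeI)
        fix c assume "c dvd a" "c dvd b"
        then have "c dvd p" "c dvd q" unfolding ab by (auto simp: power2_eq_square power3_eq_cube)
        then show "is_unit c" using cpq coprime_common_divisor by blast
      qed
      have opp: "odd (a + b)" using \<open>odd s\<close> ab(3) by auto
      have prod: "p = a * ((a - 3 * b) * (a + 3 * b))" unfolding ab(1) by algebra
      then have "\<not> 3 dvd a" using False by auto
      then have a3: "coprime a 3" using prime_imp_coprime[of "3::int" a] by (simp add: coprime_commute)
      have "coprime a (3 * 3 * b\<^sup>2)" using a3 cab by (simp only: coprime_mult_right_iff coprime_power_right_iff) simp
      then have "coprime a (- (3 * 3 * b\<^sup>2))" by (simp only: coprime_minus_right_iff)
      then have "coprime a (a * a + - (3 * 3 * b\<^sup>2))" by (rule coprime_dvd_add) simp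
      moreover have "(a - 3 * b) * (a + 3 * b) = a * a + - (3 * 3 * b\<^sup>2)" by algebra
      ultimately have c1: "coprime a ((a - 3 * b) * (a + 3 * b))" by simp
      have "odd (a - 3 * b)" using opp by simp
      then have "coprime (a - 3 * b) (2 * a)" using c1 by (simp add: coprime_commute)
      then have "coprime (a - 3 * b) (- (a - 3 * b) + 2 * a)"
        by (rule coprime_dvd_add) (simp only: dvd_minus_iff dvd_refl)
      then have c2: "coprime (a - 3 * b) (a + 3 * b)" by simp
      obtain Z t where Zt: "a = Z ^ 3" "(a - 3 * b) * (a + 3 * b) = t ^ 3"
        using coprime_product_cube[OF c1] prod rs(1) by metis
      obtain X Y where XY: "a - 3 * b = X ^ 3" "a + 3 * b = Y ^ 3"
        using coprime_product_cube[OF c2 Zt(2)] .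
      \<comment> \<open>The three factors of \<open>p\<close> satisfy
        \<open>(a - 3 * b) + (a + 3 * b) = 2 * a\<close>; the trivial solution would give
        \<open>b = 0\<close>, hence \<open>q = 0\<close>.\<close>
      have "X ^ 3 + Y ^ 3 = 2 * Z ^ 3" using XY Zt(1) by simp
      moreover have "coprime X Y" using c2 unfolding XY by simp
      moreover have "Z \<noteq> 0" using \<open>p \<noteq> 0\<close> prod Zt(1) by auto
      moreover have "Z ^ 3 dvd p" using prod Zt(1) by simp
      ultimately have "X = Y" using less.hyps smaller by blast
      then have "b = 0" using XY by simp
      then show False using ab(2) \<open>q \<noteq> 0\<close> by simp
    next
      case True
      then obtain t where t: "p = 3 * t" by auto
      have q3: "\<not> 3 dvd q" using cpq True coprime_common_divisor[of p q 3] by auto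
      have 9: "z ^ 3 = 9 * (t * (q\<^sup>2 + 3 * t\<^sup>2))" using pz t by (simp add: power2_eq_square algebra_simps)
      then have "3 dvd z ^ 3" by simp
      then have "3 dvd z" by (simp add: prime_dvd_power_iff)
      then obtain w where w: "z = 3 * w" by auto
      have tw: "t * (q\<^sup>2 + 3 * t\<^sup>2) = 3 * w ^ 3" using 9 w by (simp add: power_mult_distrib)
      then have "3 dvd t * (q\<^sup>2 + 3 * t\<^sup>2)" by simp
      then have "3 dvd t \<or> 3 dvd q\<^sup>2 + 3 * t\<^sup>2" by (simp add: prime_dvd_mult_iff)
      moreover have "\<not> 3 dvd q\<^sup>2" using q3 by (simp add: prime_dvd_power_iff)
      ultimately have "3 dvd t" by (metis dvd_add_left_iff dvd_triv_left)
      then obtain g where g: "t = 3 * g" by auto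
      \<comment> \<open>Here \<open>p = 9 * g\<close> and \<open>z = 3 * w\<close>, and 27 has been
        cancelled. The roles are now exchanged: the norm form is applied to the pair
        \<open>(q, 3 * g)\<close>.\<close>
      have gw: "g * (q\<^sup>2 + 3 * (3 * g)\<^sup>2) = w ^ 3" using tw g by simp
      have "coprime g q" using cpq t g by simp
      then have "coprime g (q\<^sup>2)" by simp
      then have "coprime g (3 * (3 * g)\<^sup>2 + q\<^sup>2)" by (rule coprime_dvd_add) simp
      then have "coprime g (q\<^sup>2 + 3 * (3 * g)\<^sup>2)" by (simp only: add.commute)
      then obtain r s where rs: "g = r ^ 3" "q\<^sup>2 + 3 * (3 * g)\<^sup>2 = s ^ 3"
        using gw coprime_product_cube by blast
      have "odd (q\<^sup>2 + 3 * (3 * g)\<^sup>2)" using odd t g by auto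
      then have "odd (s ^ 3)" unfolding rs(2) .
      then have "odd s" by simp
      have cqg: "coprime q (3 * g)"
        using cpq unfolding t g[symmetric] by (simp add: coprime_commute)
      obtain a b where ab: "q = a ^ 3 - 9 * a * b\<^sup>2" "3 * g = 3 * a\<^sup>2 * b - 3 * b ^ 3"
          "s = a\<^sup>2 + 3 * b\<^sup>2"
        using cube_norm_form[OF rs(2) cqg \<open>odd s\<close>] by blast
      have cab: "coprime a b"
      proof (rule coprimeI)
        fix c assume "c dvd a" "c dvd b"
        then have "c dvd q" "c dvd 3 * g" unfolding ab by (auto simp: power2_eq_square power3_eq_cube)
        then show "is_unit c" using cqg coprime_common_divisor by blast
      qed
      have opp: "odd (a + b)" using \<open>odd s\<close> ab(3) by auto
      have prod: "g = b * ((a - b) * (a + b))"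
        using ab(2) by (simp add: power2_eq_square power3_eq_cube algebra_simps)
      have "coprime b (a * a)" using cab by (simp add: coprime_commute)
      then have "coprime b (- (b * b) + a * a)" by (rule coprime_dvd_add) simp
      moreover have "(a - b) * (a + b) = - (b * b) + a * a" by algebra
      ultimately have c1: "coprime b ((a - b) * (a + b))" by simp
      have "odd (a - b)" using opp by simp
      then have "coprime (a - b) (2 * b)" using c1 by (simp add: coprime_commute)
      then have "coprime (a - b) ((a - b) + 2 * b)" by (rule coprime_dvd_add) simp
      then have c2: "coprime (a - b) (a + b)" by (simp add: algebra_simps)
      obtain Z t' where Zt: "b = Z ^ 3" "(a - b) * (a + b) = t' ^ 3"
        using coprime_product_cube[OF c1] prod rs(1) by metis
      obtain X Y where XY: "a - b = X ^ 3" "a + b = Y ^ 3"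
        using coprime_product_cube[OF c2 Zt(2)] .
      \<comment> \<open>Now the factors of \<open>g\<close> are related by
        \<open>(a + b) - (a - b) = 2 * b\<close>, which accounts for the minus sign.\<close>
      have "(- X) ^ 3 + Y ^ 3 = 2 * Z ^ 3" using XY Zt(1) by simp
      moreover have "coprime (- X) Y" using c2 unfolding XY by simp
      moreover have "g \<noteq> 0" using \<open>p \<noteq> 0\<close> t g by auto
      then have "Z \<noteq> 0" using prod Zt(1) by auto
      moreover have "Z ^ 3 dvd p" using prod Zt(1) t g by simp
      ultimately have "- X = Y" using less.hyps smaller by blast
      then have "a = 0" using XY by auto
      then show False using ab(1) \<open>q \<noteq> 0\<close> by simp
    qed
  qed
qed

section \<open>Three consecutive integers of the form \<open>u ^ 3\<close>,
  \<open>2 * v ^ 3\<close>, \<open>3 * w ^ 3\<close>\<close>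

lemma cube_mod_9: "(u::int) ^ 3 mod 9 \<in> {0, 1, 8}"
proof -
  have "u mod 9 \<in> {0, 1, 2, 3, 4, 5, 6, 7, 8}" by (simp; presburger)
  moreover have "u ^ 3 mod 9 = (u mod 9) ^ 3 mod 9" by (simp add: power_mod)
  ultimately show ?thesis by auto
qed

lemma three_consecutive_cases:
  fixes A B C N :: nat
  assumes eq: "{A, B, C} = {N + 1, N + 2, N + 3}"
  shows "A = B + 1 \<or> B = A + 1 \<or> A = B + 2 \<and> A = C + 1 \<or> B = A + 2 \<and> B = C + 1"
proof -
  have B: "B = N + 1 \<or> B = N + 2 \<or> B = N + 3"
    and m: "N + 1 = A \<or> N + 1 = B \<or> N + 1 = C" "N + 2 = A \<or> N + 2 = B \<or> N + 2 = C"
    "N + 3 = A \<or> N + 3 = B \<or> N + 3 = C"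
    using eq by blast+
  have "A = N + 1 \<or> A = N + 2 \<or> A = N + 3" using eq by blast
  then show ?thesis
  proof (elim disjE)
    assume A: "A = N + 1"
    from B show ?thesis
      by (elim disjE) (use m in \<open>simp_all add: A\<close>)
  next
    assume A: "A = N + 2"
    from B show ?thesis
      by (elim disjE) (use m in \<open>simp_all add: A\<close>)
  next
    assume A: "A = N + 3"
    from B show ?thesis
      by (elim disjE) (use m in \<open>simp_all add: A\<close>)
  qed
qed

text \<open>If \<open>u ^ 3\<close> and \<open>2 * v ^ 3\<close> are adjacent, then
  \<open>u ^ 3\<close> plus or minus 1 is twice a cube, which the descent excludes. Otherwise
  \<open>3 * w ^ 3\<close> lies between them, which is impossible modulo 9.\<close>

lemma cube_double_triple_not_consecutive:
  fixes N u v w :: nat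
  assumes "N \<ge> 3" and eq: "{u ^ 3, 2 * v ^ 3, 3 * w ^ 3} = {N + 1, N + 2, N + 3}"
  shows False
proof -
  define U V W where "U = int (u ^ 3)" and "V = int (v ^ 3)" and "W = int (w ^ 3)"
  have "u ^ 3 \<in> {N + 1, N + 2, N + 3}" using eq by blast
  \<comment> \<open>This excludes the trivial solution \<open>u = e\<close> below, and also
    \<open>v = 0\<close>.\<close>
  then have "u ^ 3 > 3" using \<open>N \<ge> 3\<close> by (elim insertE emptyE) simp_all
  then have U3: "U > 3" by (simp add: U_def del: of_nat_power)
  have "U = 2 * V + 1 \<or> U + 1 = 2 * V \<or> U = 2 * V + 2 \<and> U = 3 * W + 1 \<or> 2 * V = U + 2 \<and> 2 * V = 3 * W + 1"
    using three_consecutive_cases[OF eq] unfolding U_def V_def W_def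
    by (elim disjE) (simp_all del: of_nat_power)
  then have cases: "U = 2 * V + 1 \<or> U + 1 = 2 * V \<or>
      (\<exists>e\<in>{1, -1}. U = 2 * V + 2 * e \<and> U = 3 * W + e)"
    by (elim disjE) simp_all
  have adj: False if "e \<in> {1, -1}" "U + e ^ 3 = 2 * V" for e :: int
  proof -
    have "V \<noteq> 0" using that U3 by auto
    then have "int v \<noteq> 0" by (simp add: V_def)
    moreover have "coprime (int u) e" using that(1) by auto
    ultimately have "int u = e"
      using sum_of_cubes_eq_twice_cube[of "int u" e "int v"] that(2) by (simp add: U_def V_def)
    then show False using that(1) U3 by (auto simp: U_def)
  qed
  have "\<exists>e\<in>{1, -1}. U = 2 * V + 2 * e \<and> U = 3 * W + e"
    using cases adj[of 1] adj[of "-1"] by auto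
  then obtain e where e: "e \<in> {1, -1}" "U = 2 * V + 2 * e" "U = 3 * W + e" by blast
  have "U mod 9 = (2 * (V mod 9) + 2 * e) mod 9"
    unfolding e(2) by (metis mod_add_left_eq mod_mult_right_eq)
  moreover have "U mod 9 = (3 * (W mod 9) + e) mod 9"
    unfolding e(3) by (metis mod_add_left_eq mod_mult_right_eq)
  moreover have "U mod 9 \<in> {0, 1, 8}" "V mod 9 \<in> {0, 1, 8}" "W mod 9 \<in> {0, 1, 8}"
    unfolding U_def V_def W_def of_nat_power by (rule cube_mod_9)+
  ultimately show False using e(1) by auto
qed

subsection \<open>Products of consecutive integers\<close>

lemma prod_consecutive_eq: "(\<Prod>i=1..l. N + i) = fact l * ((N + l) choose l)"
proof -
  have "fact N * (\<Prod>i=1..l. N + i) = (fact (N + l) :: nat)"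
    by (induction l) (simp_all add: algebra_simps)
  also have "\<dots> = fact N * (fact l * ((N + l) choose l))"
    using binomial_fact_lemma[of l "N + l"] by (simp add: algebra_simps)
  finally show ?thesis by simp
qed

text \<open>The distances to \<open>j\<close> run through \<open>1..j - 1\<close> on the left and
  \<open>1..l - j\<close> on the right, and \<open>fact (j - 1) * fact (l - j)\<close> divides
  \<open>fact (l - 1)\<close>.\<close>

lemma prod_distances_dvd_fact:
  assumes "j \<in> {1..l}"
  shows "(\<Prod>i\<in>{1..l} - {j}. nat \<bar>int i - int j\<bar>) dvd fact (l - 1)"
proof -
  have split: "{1..l} - {j} = {1..<j} \<union> {j<..l}" using assms by auto
  have "(\<Prod>i\<in>{1..<j}. nat \<bar>int i - int j\<bar>) = \<Prod>{1..j - 1}"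
    by (rule prod.reindex_bij_witness[of _ "\<lambda>i. j - i" "\<lambda>i. j - i"]) auto
  moreover have "(\<Prod>i\<in>{j<..l}. nat \<bar>int i - int j\<bar>) = \<Prod>{1..l - j}"
    by (rule prod.reindex_bij_witness[of _ "\<lambda>i. j + i" "\<lambda>i. i - j"]) auto
  ultimately have "(\<Prod>i\<in>{1..l} - {j}. nat \<bar>int i - int j\<bar>) = fact (j - 1) * fact (l - j)"
    unfolding split by (subst prod.union_disjoint) (auto simp: fact_prod)
  also have "\<dots> dvd fact ((j - 1) + (l - j))" by (rule fact_fact_dvd_fact)
  also have "(j - 1) + (l - j) = l - 1" using assms by auto
  finally show ?thesis .
qed

text \<open>The omitted factor \<open>N + j\<close> is one with the largest exponent of
  \<open>p\<close>; the \<open>p\<close>-part of any other factor then divides its distance to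
  \<open>N + j\<close>.\<close>

lemma multiplicity_prod_all_but_one:
  fixes p N l :: nat
  assumes "prime p" "l \<ge> 1"
  obtains j where "j \<in> {1..l}"
    "multiplicity p (\<Prod>i\<in>{1..l} - {j}. N + i) \<le> multiplicity p (fact (l - 1))"
proof -
  let ?v = "\<lambda>i. multiplicity p (N + i)"
  have "Max (?v ` {1..l}) \<in> ?v ` {1..l}" using assms(2) by (intro Max_in) auto
  then obtain j where j: "j \<in> {1..l}" "?v j = Max (?v ` {1..l})" by auto
  \<comment> \<open>A power of \<open>p\<close> dividing \<open>N + i\<close> also divides \<open>N + j\<close>, by the maximality of \<open>j\<close>.\<close>
  have le: "?v i \<le> multiplicity p (nat \<bar>int i - int j\<bar>)" if "i \<in> {1..l} - {j}" for i
  proof -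
    have "?v i \<le> ?v j" unfolding j(2) using that by (intro Max_ge) auto
    then have "p ^ ?v i dvd N + j" "p ^ ?v i dvd N + i"
      by (auto intro: multiplicity_dvd multiplicity_dvd')
    then have "int (p ^ ?v i) dvd int (N + i) - int (N + j)"
      by (meson dvd_diff int_dvd_int_iff)
    then have "int (p ^ ?v i) dvd int i - int j" by simp
    then have "p ^ ?v i dvd nat \<bar>int i - int j\<bar>"
      by (metis abs_ge_zero dvd_abs_iff int_dvd_int_iff int_nat_eq)
    then show ?thesis using that assms(1) by (intro multiplicity_geI) auto
  qed
  have "multiplicity p (\<Prod>i\<in>{1..l} - {j}. N + i) = (\<Sum>i\<in>{1..l} - {j}. ?v i)"
    using assms(1) by (intro prime_elem_multiplicity_prod_distrib) auto
  also have "\<dots> \<le> (\<Sum>i\<in>{1..l} - {j}. multiplicity p (nat \<bar>int i - int j\<bar>))"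
    by (intro sum_mono le)
  also have "\<dots> = multiplicity p (\<Prod>i\<in>{1..l} - {j}. nat \<bar>int i - int j\<bar>)"
    using assms(1) by (intro prime_elem_multiplicity_prod_distrib[symmetric]) auto
  also have "\<dots> \<le> multiplicity p (fact (l - 1))"
    by (intro dvd_imp_multiplicity_le prod_distances_dvd_fact j(1)) auto
  finally show thesis using that j(1) by blast
qed

text \<open>All factors of the numerator but \<open>N + j\<close> contribute no more of
  \<open>p\<close> than \<open>fact l\<close> cancels, so the whole power \<open>p ^ e\<close>
  divides the single factor \<open>N + j\<close>.\<close>

lemma prime_power_dvd_binomial_le:
  fixes p N l e :: nat
  assumes "prime p" "l \<ge> 1" "p ^ e dvd (N + l) choose l"
  shows "p ^ e \<le> N + l"
proof -
  obtain j where j: "j \<in> {1..l}"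
      "multiplicity p (\<Prod>i\<in>{1..l} - {j}. N + i) \<le> multiplicity p (fact (l - 1))"
    using multiplicity_prod_all_but_one[OF assms(1,2)] .
  have split: "(\<Prod>i=1..l. N + i) = (N + j) * (\<Prod>i\<in>{1..l} - {j}. N + i)"
    using j(1) by (intro prod.remove) auto
  have "multiplicity p (\<Prod>i=1..l. N + i) =
      multiplicity p (N + j) + multiplicity p (\<Prod>i\<in>{1..l} - {j}. N + i)"
    unfolding split using assms(1) j(1) by (intro prime_elem_multiplicity_mult_distrib) auto
  moreover have "multiplicity p (\<Prod>i=1..l. N + i) =
      multiplicity p (fact l :: nat) + multiplicity p ((N + l) choose l)"
    unfolding prod_consecutive_eq using assms(1)
    by (intro prime_elem_multiplicity_mult_distrib) auto
  moreover have "multiplicity p (fact (l - 1) :: nat) \<le> multiplicity p (fact l :: nat)"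
    by (intro dvd_imp_multiplicity_le fact_dvd) auto
  moreover have "e \<le> multiplicity p ((N + l) choose l)"
    using assms by (intro multiplicity_geI) auto
  ultimately have "e \<le> multiplicity p (N + j)"
    using j(2) by linarith
  then have "p ^ e dvd N + j" by (rule multiplicity_dvd')
  then have "p ^ e \<le> N + j" using j(1) by (intro dvd_imp_le) auto
  then show ?thesis using j(1) by simp
qed

section \<open>Power-free parts of consecutive integers\<close>

lemma power_free_decomposition:
  fixes n l :: nat
  assumes "n > 0" "l > 0"
  shows "\<exists>a m. n = a * m ^ l \<and> (\<forall>p. prime p \<longrightarrow> multiplicity p a < l)"
  using assms(1)
proof (induction n rule: less_induct)
  case (less n)
  show ?case
  proof (cases "\<forall>p. prime p \<longrightarrow> multiplicity p n < l")
    case True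
    then show ?thesis by (intro exI[of _ n] exI[of _ 1]) auto
  next
    case False
    then obtain p where p: "prime p" "l \<le> multiplicity p n" by (meson not_less)
    then obtain n' where n': "n = p ^ l * n'" by (meson dvdE multiplicity_dvd')
    have "p ^ l > 1" using one_less_power[OF prime_gt_1_nat[OF p(1)] assms(2)] .
    then have "n' > 0" "n' < n" using n' less.prems by auto
    then obtain a m where "n' = a * m ^ l" "\<forall>q. prime q \<longrightarrow> multiplicity q a < l"
      using less.IH by blast
    then show ?thesis
      by (intro exI[of _ a] exI[of _ "p * m"]) (auto simp: n' power_mult_distrib)
  qed
qed

text \<open>
  For every prime, the exponents in the two sides are congruent modulo \<open>l\<close>, so an excess on the left
  would be at least \<open>l\<close>; but a single factor accounts for all of the excess, and it is \<open>l\<close>-th power free.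
\<close>

lemma prod_power_free_parts_dvd_fact:
  fixes N l c :: nat and a m :: "nat \<Rightarrow> nat"
  assumes "l \<ge> 1" and dec: "\<And>i. i \<in> {1..l} \<Longrightarrow> N + i = a i * m i ^ l"
    and free: "\<And>i p. i \<in> {1..l} \<Longrightarrow> prime p \<Longrightarrow> multiplicity p (a i) < l"
    and c: "(N + l) choose l = c ^ l"
  shows "(\<Prod>i=1..l. a i) dvd fact l"
proof -
  have a0: "a i \<noteq> 0" "m i \<noteq> 0" if "i \<in> {1..l}" for i
    using dec[OF that] that \<open>l \<ge> 1\<close> by (auto simp: power_0_left intro!: Nat.gr0I)
  have c0: "c \<noteq> 0" using c \<open>l \<ge> 1\<close> by (metis le_add2 power_eq_0_iff zero_less_binomial less_irrefl not_one_le_zero neq0_conv)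
  have A0: "(\<Prod>i=1..l. a i) \<noteq> 0" and M0: "(\<Prod>i=1..l. m i) \<noteq> 0" using a0 by auto
  have eq: "(\<Prod>i=1..l. a i) * (\<Prod>i=1..l. m i) ^ l = fact l * c ^ l"
  proof -
    have "(\<Prod>i=1..l. a i) * (\<Prod>i=1..l. m i) ^ l = (\<Prod>i=1..l. a i * m i ^ l)"
      by (simp add: prod.distrib prod_power_distrib)
    also have "\<dots> = (\<Prod>i=1..l. N + i)" using dec by (intro prod.cong) auto
    finally show ?thesis by (simp only: prod_consecutive_eq c)
  qed
  show ?thesis
  proof (rule multiplicity_le_imp_dvd)
    show "(\<Prod>i=1..l. a i) \<noteq> 0" by fact
  next
    fix p :: nat assume p: "prime p"
    let ?A = "multiplicity p (\<Prod>i=1..l. a i)" and ?F = "multiplicity p (fact l :: nat)"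
    obtain j where j: "j \<in> {1..l}"
        "multiplicity p (\<Prod>i\<in>{1..l} - {j}. N + i) \<le> multiplicity p (fact (l - 1))"
      using multiplicity_prod_all_but_one[OF p \<open>l \<ge> 1\<close>] .
    have split: "(\<Prod>i=1..l. a i) = a j * (\<Prod>i\<in>{1..l} - {j}. a i)"
      using j(1) by (intro prod.remove) auto
    have "?A = multiplicity p (a j) + multiplicity p (\<Prod>i\<in>{1..l} - {j}. a i)"
      unfolding split using p a0 j(1) by (intro prime_elem_multiplicity_mult_distrib) auto
    moreover have "multiplicity p (\<Prod>i\<in>{1..l} - {j}. a i) \<le> multiplicity p (\<Prod>i\<in>{1..l} - {j}. N + i)"
    proof (intro dvd_imp_multiplicity_le prod_dvd_prod)
      show "a i dvd N + i" if "i \<in> {1..l} - {j}" for i using dec that by auto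
    qed auto
    moreover have "multiplicity p (fact (l - 1) :: nat) \<le> ?F"
      by (intro dvd_imp_multiplicity_le fact_dvd) auto
    ultimately have less: "?A < ?F + l"
      using j free[OF j(1) p] by linarith
    have "multiplicity p ((\<Prod>i=1..l. a i) * (\<Prod>i=1..l. m i) ^ l) =
        ?A + l * multiplicity p (\<Prod>i=1..l. m i)"
      using p A0 M0 by (simp add: prime_elem_multiplicity_mult_distrib prime_elem_multiplicity_power_distrib)
    moreover have "multiplicity p (fact l * c ^ l) = ?F + l * multiplicity p c"
      using p c0 by (simp add: prime_elem_multiplicity_mult_distrib prime_elem_multiplicity_power_distrib)
    ultimately have "?A + l * multiplicity p (\<Prod>i=1..l. m i) = ?F + l * multiplicity p c"
      by (simp only: eq)
    moreover have "l * multiplicity p c \<le> l * multiplicity p (\<Prod>i=1..l. m i)"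
    proof (rule ccontr)
      assume "\<not> ?thesis"
      then have "multiplicity p (\<Prod>i=1..l. m i) < multiplicity p c" by simp
      then have "l * (multiplicity p (\<Prod>i=1..l. m i) + 1) \<le> l * multiplicity p c"
        by (intro mult_left_mono) auto
      then show False using calculation less by (simp add: algebra_simps)
    qed
    ultimately show "?A \<le> ?F" by linarith
  qed
qed

text \<open>The product of \<open>k\<close> distinct positive integers is at least
  \<open>fact k\<close>. Splitting off the maximum \<open>M\<close>, the lower bound for the rest
  turns the upper bound on the product into \<open>M \<le> k\<close>. Both claims are carried
  through one induction.\<close>

lemma prod_le_fact_imp_initial_segment:
  fixes S :: "nat set"
  assumes "finite S" "0 \<notin> S" "card S = l" "\<Prod>S \<le> fact l"
  shows "S = {1..l}"
proof -
  have "fact (card S) \<le> \<Prod>S \<and> (\<Prod>S \<le> fact (card S) \<longrightarrow> S \<subseteq> {1..card S})"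
    if "finite S" "0 \<notin> S" for S :: "nat set"
    using that
  proof (induction "card S" arbitrary: S)
    case 0
    then show ?case by simp
  next
    case (Suc k)
    define M where "M = Max S"
    have ne: "S \<noteq> {}" using Suc.hyps(2) by auto
    have MS: "M \<in> S" unfolding M_def using Suc.prems(1) ne by (rule Max_in)
    have "S \<subseteq> {1..M}"
    proof
      fix s assume "s \<in> S"
      then have "s \<noteq> 0" "s \<le> M" using Suc.prems Max_ge[of S s] unfolding M_def by metis+
      then show "s \<in> {1..M}" by simp
    qed
    then have sub: "S \<subseteq> {1..M}" .
    then have "card S \<le> M" using card_mono[of "{1..M}" S] by simp
    then have kM: "Suc k \<le> M" using Suc.hyps(2) by simp
    have ck: "k = card (S - {M})" using Suc.hyps(2) Suc.prems(1) MS by simp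
    have IH: "fact k \<le> \<Prod>(S - {M})"
      using Suc.hyps(1)[OF ck] Suc.prems ck by simp
    have prod: "\<Prod>S = M * \<Prod>(S - {M})" using Suc.prems(1) MS by (rule prod.remove)
    have "fact (Suc k) \<le> \<Prod>S"
      unfolding prod using mult_mono[OF kM IH] by (simp add: algebra_simps)
    moreover have "S \<subseteq> {1..Suc k}" if "\<Prod>S \<le> fact (Suc k)"
    proof -
      have "M * fact k \<le> M * \<Prod>(S - {M})" using IH by simp
      also have "\<dots> \<le> Suc k * fact k" using that prod by simp
      finally have "M \<le> Suc k" by (simp only: mult_le_cancel2 fact_gt_zero)
      then show ?thesis using sub by auto
    qed
    ultimately show ?case using Suc.hyps(2) by metis
  qed
  then have "S \<subseteq> {1..l}" using assms by metis
  then show ?thesis using assms(3) by (intro card_subset_eq) auto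
qed

text \<open>These are the two leading terms of the binomial expansion; for \<open>l = 0\<close> the
  truncated exponent is harmless, its coefficient being 0.\<close>

lemma power_Suc_base_ge: "(t + 1) ^ l \<ge> t ^ l + l * t ^ (l - 1)" for t l :: nat
proof (induction l)
  case (Suc l)
  have "t ^ Suc l + Suc l * t ^ l \<le> (t + 1) * (t ^ l + l * t ^ (l - 1))"
    by (cases l) (simp_all add: algebra_simps)
  also have "\<dots> \<le> (t + 1) * (t + 1) ^ l" using Suc.IH by (rule mult_left_mono) simp
  finally show ?case by simp
qed simp

text \<open>Equal power-free parts \<open>a i = a j\<close> with \<open>m i < m j\<close> would put
  the two factors at least \<open>l\<close> apart, so the parts are distinct. Their product is at
  most \<open>fact l\<close>, so they are exactly \<open>1..l\<close>, and \<open>g t\<close> is the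
  position of the factor with part \<open>t\<close>.\<close>

lemma consecutive_power_multiples:
  fixes N l c :: nat
  assumes l: "l \<ge> 1" and "N \<ge> l" and c: "(N + l) choose l = c ^ l"
  obtains g b where "bij_betw g {1..l} {1..l}"
    "\<And>t. t \<in> {1..l} \<Longrightarrow> N + g t = t * b t ^ l" "\<And>t. t \<in> {1..l} \<Longrightarrow> b t \<ge> 2"
proof -
  have "\<forall>i. \<exists>a m. i \<in> {1..l} \<longrightarrow> N + i = a * m ^ l \<and> (\<forall>p. prime p \<longrightarrow> multiplicity p a < l)"
    using power_free_decomposition[of _ l] l by (metis add_gr_0 atLeastAtMost_iff less_le_trans zero_less_one)
  then obtain a m where am: "\<And>i. i \<in> {1..l} \<Longrightarrow> N + i = a i * m i ^ l"
      "\<And>i p. i \<in> {1..l} \<Longrightarrow> prime p \<Longrightarrow> multiplicity p (a i) < l"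
    by metis
  have pos: "a i > 0" "m i > 0" if "i \<in> {1..l}" for i
    using am(1)[OF that] that l by (auto simp: power_0_left intro!: Nat.gr0I)
  have no_eq: False if ij: "i \<in> {1..l}" "j \<in> {1..l}" "a i = a j" "m i < m j" for i j
  proof -
    have "l * 1 \<le> l * m i ^ (l - 1)" using pos[OF ij(1)] by simp
    then have "m i ^ l + l \<le> (m i + 1) ^ l" using power_Suc_base_ge[of "m i" l] by linarith
    also have "\<dots> \<le> m j ^ l" using ij(4) by (intro power_mono) auto
    finally have "a i * (m i ^ l + l) \<le> a i * m j ^ l" by simp
    then have "N + i + a i * l \<le> N + j"
      unfolding am(1)[OF ij(1)] am(1)[OF ij(2)] by (simp add: ij(3) algebra_simps)
    moreover have "l \<le> a i * l" using pos[OF ij(1)] by simp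
    moreover have "1 \<le> i" "j \<le> l" using ij by simp_all
    ultimately show False by linarith
  qed
  have inj: "inj_on a {1..l}"
  proof (rule inj_onI)
    fix i j assume ij: "i \<in> {1..l}" "j \<in> {1..l}" "a i = a j"
    then have "m i = m j" using no_eq[of i j] no_eq[of j i] by (metis linorder_neqE_nat)
    then show "i = j" using am(1)[OF ij(1)] am(1)[OF ij(2)] ij(3) by simp
  qed
  have "\<Prod>(a ` {1..l}) = (\<Prod>i=1..l. a i)" using inj by (simp add: prod.reindex)
  also have "\<dots> \<le> fact l"
    using prod_power_free_parts_dvd_fact[OF l am c] by (intro dvd_imp_le) auto
  finally have le: "\<Prod>(a ` {1..l}) \<le> fact l" .
  have "0 \<notin> a ` {1..l}" using pos(1) by fastforce
  then have im: "a ` {1..l} = {1..l}"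
    using inj le by (intro prod_le_fact_imp_initial_segment) (simp_all add: card_image)
  then have bij: "bij_betw a {1..l} {1..l}" using inj by (simp add: bij_betw_def)
  define g where "g = inv_into {1..l} a"
  have g: "bij_betw g {1..l} {1..l}" unfolding g_def using bij by (rule bij_betw_inv_into)
  have gt: "g t \<in> {1..l}" "a (g t) = t" if "t \<in> {1..l}" for t
    using bij_betw_apply[OF g that] bij_betw_inv_into_right[OF bij that] by (simp_all add: g_def)
  have dec: "N + g t = t * m (g t) ^ l" if "t \<in> {1..l}" for t
    using am(1)[OF gt(1)[OF that]] gt(2)[OF that] by simp
  \<comment> \<open>A base 1 would give \<open>N + g t = t\<close>, although
    \<open>t \<le> l \<le> N\<close> and \<open>g t\<close> is positive.\<close>
  have "m (g t) \<ge> 2" if "t \<in> {1..l}" for t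
  proof (rule ccontr)
    assume "\<not> m (g t) \<ge> 2"
    then have "m (g t) = 1" using pos(2)[OF gt(1)[OF that]] by simp
    then have "N + g t = t" using dec[OF that] by simp
    then show False using that gt(1)[OF that] \<open>N \<ge> l\<close> by simp
  qed
  then show thesis using that[of g "\<lambda>t. m (g t)"] g dec by blast
qed

section \<open>Separation of \<open>u ^ l\<close>, \<open>2 * v ^ l\<close> and
  \<open>4 * w ^ l\<close>\<close>

lemma square_less_power_two: "l\<^sup>2 < 8 * 2 ^ l" for l :: nat
proof (induction l)
  case (Suc l)
  have sq: "(Suc l)\<^sup>2 = l\<^sup>2 + 2 * l + 1" by (simp add: power2_eq_square)
  consider "l = 0" | "l = 1" | "l \<ge> 2" by linarith
  then show ?case
  proof cases
    case 3
    then have "2 * l \<le> l\<^sup>2" unfolding power2_eq_square by (intro mult_le_mono1)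
    then show ?thesis using Suc.IH by (simp add: sq)
  qed (simp_all add: power2_eq_square)
qed simp

text \<open>The gap \<open>4 * (s ^ l - t ^ l)\<close> is at least
  \<open>4 * l * t ^ (l - 1)\<close>, while the interval from \<open>(N + 1) ^ 2\<close> to
  \<open>(N + l) ^ 2\<close> is shorter than \<open>3 * l * (N + 1)\<close>. As \<open>N + 1\<close>
  is at most twice the square root of \<open>t ^ l\<close>, squaring leaves
  \<open>16 * t ^ (l - 2) < 36\<close>.\<close>

lemma distinct_power_products_far:
  fixes l N s t :: nat
  assumes "l \<ge> 3" "N \<ge> l" "t \<ge> 4" "t < s"
    and "(N + 1)\<^sup>2 \<le> 4 * t ^ l" "4 * s ^ l \<le> (N + l)\<^sup>2"
  shows False
proof -
  have "4 * (t ^ l + l * t ^ (l - 1)) \<le> 4 * s ^ l"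
  proof -
    have "(t + 1) ^ l \<le> s ^ l" using assms(4) by (intro power_mono) auto
    then have "t ^ l + l * t ^ (l - 1) \<le> s ^ l" using power_Suc_base_ge[of t l] by (rule order_trans[rotated])
    then show ?thesis by simp
  qed
  then have "(N + 1)\<^sup>2 + l * (4 * t ^ (l - 1)) \<le> (N + l)\<^sup>2" using assms(5,6) by (simp add: algebra_simps)
  moreover have "(N + l)\<^sup>2 < (N + 1)\<^sup>2 + l * (3 * (N + 1))"
  proof -
    have "l * l \<le> l * N" using assms(2) by simp
    moreover have "(N + l)\<^sup>2 = N\<^sup>2 + 2 * (l * N) + l * l" "(N + 1)\<^sup>2 = N\<^sup>2 + 2 * N + 1"
      "l * (3 * (N + 1)) = 3 * (l * N) + 3 * l"
      by (simp_all add: power2_eq_square algebra_simps)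
    ultimately show ?thesis by linarith
  qed
  ultimately have "l * (4 * t ^ (l - 1)) < l * (3 * (N + 1))" by linarith
  then have "4 * t ^ (l - 1) < 3 * (N + 1)" by simp
  then have "(4 * t ^ (l - 1))\<^sup>2 < (3 * (N + 1))\<^sup>2" by (intro power_strict_mono) auto
  also have "\<dots> = 9 * (N + 1)\<^sup>2" by (simp add: power2_eq_square algebra_simps)
  also have "\<dots> \<le> 36 * t ^ l" using assms(5) by linarith
  finally have "16 * (t ^ (l - 1))\<^sup>2 < 36 * t ^ l" by (simp add: power_mult_distrib)
  moreover have "(t ^ (l - 1))\<^sup>2 = t ^ l * t ^ (l - 2)"
  proof -
    obtain k where "l = k + 2" using assms(1) by (intro that[of "l - 2"]) simp
    then show ?thesis by (simp add: power2_eq_square power_add algebra_simps)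
  qed
  ultimately have "t ^ l * (16 * t ^ (l - 2)) < t ^ l * 36" by (simp add: algebra_simps)
  then have "16 * t ^ (l - 2) < 36" by (simp only: mult_less_cancel1)
  moreover have "t ^ 1 \<le> t ^ (l - 2)" using assms(1,3) by (intro power_increasing) auto
  ultimately show False using assms(3) by simp
qed

text \<open>The square of the middle term is \<open>4 * (v ^ 2) ^ l\<close> and the product of the
  outer terms is \<open>4 * (u * w) ^ l\<close>. Both lie between \<open>(N + 1) ^ 2\<close> and
  \<open>(N + l) ^ 2\<close>, so \<open>distinct_power_products_far\<close> leaves only
  \<open>v ^ 2 = u * w\<close>.\<close>

lemma power_multiples_1_2_4_spread:
  fixes l N u v w :: nat
  assumes "l \<ge> 3" "N \<ge> l" "u \<ge> 2" "v \<ge> 2" "w \<ge> 2" "u ^ l \<noteq> 4 * w ^ l"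
    and mem: "u ^ l \<in> {N + 1..N + l}" "2 * v ^ l \<in> {N + 1..N + l}" "4 * w ^ l \<in> {N + 1..N + l}"
  shows False
proof -
  have sq: "4 * (v\<^sup>2) ^ l = (2 * v ^ l)\<^sup>2" by (simp add: power_mult_distrib mult.commute flip: power_mult)
  have uw: "4 * (u * w) ^ l = u ^ l * (4 * w ^ l)" by (simp add: power_mult_distrib)
  have v_le: "N + 1 \<le> 2 * v ^ l" "2 * v ^ l \<le> N + l" using mem(2) by simp_all
  have b1: "(N + 1)\<^sup>2 \<le> 4 * (v\<^sup>2) ^ l" "4 * (v\<^sup>2) ^ l \<le> (N + l)\<^sup>2"
    unfolding sq using power_mono[OF v_le(1) le0] power_mono[OF v_le(2) le0] by blast+
  have b2: "(N + 1)\<^sup>2 \<le> 4 * (u * w) ^ l" "4 * (u * w) ^ l \<le> (N + l)\<^sup>2"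
  proof -
    have le: "N + 1 \<le> u ^ l" "u ^ l \<le> N + l" "N + 1 \<le> 4 * w ^ l" "4 * w ^ l \<le> N + l"
      using mem(1,3) by simp_all
    show "(N + 1)\<^sup>2 \<le> 4 * (u * w) ^ l" "4 * (u * w) ^ l \<le> (N + l)\<^sup>2"
      unfolding uw power2_eq_square
      using mult_mono[OF le(1,3) le0 le0] mult_mono[OF le(2,4) le0 le0] by blast+
  qed
  have v4: "v\<^sup>2 \<ge> 4" using power_mono[OF assms(4), of 2] by simp
  have uw4: "u * w \<ge> 4" using mult_mono[OF assms(3,5)] by simp
  consider "v\<^sup>2 < u * w" | "u * w < v\<^sup>2" | "v\<^sup>2 = u * w" by linarith
  then show False
  proof cases
    case 1
    then show ?thesis using distinct_power_products_far[OF assms(1,2) v4] b1 b2 by blast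
  next
    case 2
    then show ?thesis using distinct_power_products_far[OF assms(1,2) uw4] b1 b2 by blast
  next
    case 3
    \<comment> \<open>Now \<open>B\<close> is the geometric mean of the distinct integers
      \<open>A\<close> and \<open>D\<close>, so \<open>A + D\<close> is at least
      \<open>2 * B + 1\<close> and \<open>(A - D) ^ 2\<close> at least \<open>4 * B + 1\<close>.
      This exceeds \<open>l ^ 2\<close>, because \<open>B\<close> is at least
      \<open>2 * 2 ^ l\<close>.\<close>
    define A B D where "A = int (u ^ l)" and "B = int (2 * v ^ l)" and "D = int (4 * w ^ l)"
    have "(2 * v ^ l)\<^sup>2 = u ^ l * (4 * w ^ l)" using sq uw 3 by simp
    then have BAD: "B\<^sup>2 = A * D" unfolding A_def B_def D_def by (metis of_nat_mult of_nat_power)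
    have "A \<noteq> D" using assms(6) unfolding A_def D_def of_nat_eq_iff .
    then have "(A - D)\<^sup>2 > 0" by simp
    moreover have AD: "(A + D)\<^sup>2 = (A - D)\<^sup>2 + (2 * B)\<^sup>2" using BAD by (simp add: power2_eq_square algebra_simps)
    ultimately have "(2 * B)\<^sup>2 < (A + D)\<^sup>2" by simp
    then have "2 * B < A + D" by (rule power_less_imp_less_base) (simp add: A_def D_def)
    then have "(2 * B + 1)\<^sup>2 \<le> (A + D)\<^sup>2" by (intro power_mono) (simp_all add: B_def)
    then have "4 * B + 1 \<le> (A - D)\<^sup>2" unfolding AD by (simp add: power2_eq_square algebra_simps)
    also have "\<dots> \<le> (int l)\<^sup>2"
    proof -
      have "int (N + 1) \<le> A" "A \<le> int (N + l)" "int (N + 1) \<le> D" "D \<le> int (N + l)"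
        unfolding A_def D_def of_nat_le_iff using mem(1,3) by simp_all
      then have "\<bar>A - D\<bar> \<le> \<bar>int l\<bar>" by simp
      then show ?thesis by (simp only: abs_le_square_iff)
    qed
    finally have "int (4 * (2 * v ^ l)) < int (l\<^sup>2)" unfolding B_def by simp
    then have "8 * v ^ l < l\<^sup>2" by (simp only: of_nat_less_iff)
    moreover have "2 ^ l \<le> v ^ l" using assms(4) by (intro power_mono) auto
    ultimately show False using square_less_power_two[of l] by linarith
  qed
qed

lemma binomial_ne_own_power:
  fixes N l c :: nat
  assumes "l \<ge> 3" "N \<ge> 1"
  shows "(N + l) choose l \<noteq> c ^ l"
proof
  assume c: "(N + l) choose l = c ^ l"
  show False
  proof (cases "N < l")
    case True
    have "c ^ l \<le> 2 ^ (N + l)" unfolding c[symmetric] by (rule binomial_le_pow2)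
    also have "(2::nat) ^ (N + l) < 2 ^ (2 * l)" using True by (intro power_strict_increasing) auto
    also have "\<dots> = 4 ^ l" by (simp add: power_mult)
    finally have "c < 4" by (rule power_less_imp_less_base) simp
    moreover have "c \<noteq> 0"
    proof
      assume "c = 0"
      then have "(N + l) choose l = 0" using c assms(1) by (simp add: power_0_left)
      then show False by simp
    qed
    \<comment> \<open>Pascal's rule gives two positive summands; the second is positive because
      \<open>N \<ge> 1\<close>.\<close>
    moreover have "c \<noteq> 1"
    proof -
      have "(N + l) choose l = (N + l - 1 choose (l - 1)) + (N + l - 1 choose l)"
        using assms by (intro choose_reduce_nat) auto
      moreover have "N + l - 1 choose (l - 1) > 0" "N + l - 1 choose l > 0"
        using assms by (simp_all only: zero_less_binomial_iff)
      ultimately have "(N + l) choose l > 1" by linarith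
      then show ?thesis using c by auto
    qed
    ultimately have "c = 2 \<or> c = 3" by linarith
    then have pc: "prime c" "c \<ge> 2" by auto
    then have "c ^ l \<le> N + l"
      using assms(1) c by (intro prime_power_dvd_binomial_le) auto
    moreover have "2 ^ l \<le> c ^ l" using pc(2) by (intro power_mono) auto
    moreover have "2 * l \<le> 2 ^ l"
    proof -
      have "l - 1 < 2 ^ (l - 1)" by (rule less_exp)
      then have "2 * l \<le> 2 * 2 ^ (l - 1)" by linarith
      then show ?thesis using assms(1) by (simp flip: power_Suc)
    qed
    ultimately show False using True by linarith
  next
    case False
    then have "N \<ge> l" by simp
    obtain g b where g: "bij_betw g {1..l} {1..l}"
      and b: "\<And>t. t \<in> {1..l} \<Longrightarrow> N + g t = t * b t ^ l" "\<And>t. t \<in> {1..l} \<Longrightarrow> b t \<ge> 2"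
      using consecutive_power_multiples[OF _ \<open>N \<ge> l\<close> c] assms(1) by (metis le_trans one_le_numeral)
    show False
    proof (cases "l = 3")
      case True
      have l3: "{1..l} = {1, 2, 3}" unfolding True by auto
      have "{b 1 ^ 3, 2 * b 2 ^ 3, 3 * b 3 ^ 3} = (\<lambda>t. N + g t) ` {1..l}"
        using b(1)[of 1] b(1)[of 2] b(1)[of 3] unfolding l3 by (simp add: True)
      also have "\<dots> = (+) N ` g ` {1..l}" by (simp add: image_image)
      also have "\<dots> = {N + 1, N + 2, N + 3}" using g unfolding bij_betw_def l3 by simp
      finally show False using \<open>N \<ge> l\<close> True cube_double_triple_not_consecutive by blast
    next
      case False
      \<comment> \<open>From 4 on, the index 4 is available in \<open>1..l\<close>; injectivity of
        \<open>g\<close> then separates the outer terms.\<close>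
      then have l4: "l \<ge> 4" using assms(1) by simp
      then have t: "1 \<in> {1..l}" "2 \<in> {1..l}" "4 \<in> {1..l}" by auto
      have mem: "N + g t \<in> {N + 1..N + l}" if "t \<in> {1..l}" for t
        using bij_betw_apply[OF g that] by simp
      have "g 1 \<noteq> g 4" using g t unfolding bij_betw_def inj_on_def
        by (metis numeral_eq_one_iff semiring_norm(83))
      then have "b 1 ^ l \<noteq> 4 * b 4 ^ l" using b(1)[OF t(1)] b(1)[OF t(3)] by simp
      then show False
        using power_multiples_1_2_4_spread[OF assms(1) \<open>N \<ge> l\<close>, of "b 1" "b 2" "b 4"]
          b(2)[OF t(1)] b(2)[OF t(2)] b(2)[OF t(3)]
          mem[OF t(1)] mem[OF t(2)] mem[OF t(3)] b(1)[OF t(1)] b(1)[OF t(2)] b(1)[OF t(3)]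
        by simp
    qed
  qed
qed

subsection \<open>The inequality of the means for subset products\<close>

text \<open>The defects \<open>d i\<close> of \<open>ln t \<le> t - 1\<close> at
  \<open>t = y i / A\<close>, with \<open>A\<close> the mean, are nonnegative and add up to the
  difference of the two sides. Equality makes each defect vanish, which happens only at
  \<open>t = 1\<close>.\<close>

lemma sum_ln_le_card_ln_mean:
  fixes y :: "'a \<Rightarrow> real"
  assumes "finite S" "S \<noteq> {}" and pos: "\<And>i. i \<in> S \<Longrightarrow> y i > 0"
  shows "(\<Sum>i\<in>S. ln (y i)) \<le> card S * ln (sum y S / card S)"
    and "(\<Sum>i\<in>S. ln (y i)) = card S * ln (sum y S / card S) \<Longrightarrow> i \<in> S \<Longrightarrow> y i = sum y S / card S"
proof -
  define A where "A = sum y S / card S"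
  have cS: "real (card S) > 0" using assms(1,2) by (simp add: card_gt_0_iff)
  have "sum y S > 0" using assms by (intro sum_pos) auto
  then have A: "A > 0" using cS by (simp add: A_def)
  define d where "d i = y i / A - 1 - ln (y i / A)" for i
  have d: "d i \<ge> 0" if "i \<in> S" for i
    using ln_le_minus_one[of "y i / A"] pos[OF that] A by (simp add: d_def)
  have "(\<Sum>i\<in>S. d i) = sum y S / A - card S - (\<Sum>i\<in>S. ln (y i / A))"
    by (simp add: d_def sum_subtractf sum_divide_distrib)
  also have "sum y S / A = card S" using cS A by (simp add: A_def field_simps)
  also have "(\<Sum>i\<in>S. ln (y i / A)) = (\<Sum>i\<in>S. ln (y i) - ln A)"
    using pos A by (intro sum.cong refl ln_divide_pos)
  also have "\<dots> = (\<Sum>i\<in>S. ln (y i)) - card S * ln A" by (simp add: sum_subtractf)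
  finally have sum_d: "(\<Sum>i\<in>S. d i) = card S * ln A - (\<Sum>i\<in>S. ln (y i))" by simp
  moreover have "(\<Sum>i\<in>S. d i) \<ge> 0" using d by (intro sum_nonneg) auto
  ultimately show "(\<Sum>i\<in>S. ln (y i)) \<le> card S * ln (sum y S / card S)" by (simp add: A_def)
  assume "(\<Sum>i\<in>S. ln (y i)) = card S * ln (sum y S / card S)" and i: "i \<in> S"
  then have "(\<Sum>i\<in>S. d i) = 0" using sum_d by (simp add: A_def)
  then have "d i = 0" using d i assms(1) by (simp add: sum_nonneg_eq_0_iff)
  then have "ln (y i / A) = y i / A - 1" by (simp add: d_def)
  then have "y i / A = 1" using pos[OF i] A by (intro ln_eq_minus_one) simp_all
  then have "y i = A" using A by simp
  then show "y i = sum y S / card S" by (simp only: A_def)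
qed

lemma card_subsets_containing:
  assumes "1 \<le> k" "i \<in> {1..n}"
  shows "card {I. I \<subseteq> {1..n} \<and> card I = k \<and> i \<in> I} = (n - 1) choose (k - 1)"
proof -
  have "bij_betw (insert i) {J. J \<subseteq> {1..n} - {i} \<and> card J = k - 1}
      {I. I \<subseteq> {1..n} \<and> card I = k \<and> i \<in> I}"
  proof (rule bij_betw_byWitness[where f' = "\<lambda>I. I - {i}"])
    show "insert i ` {J. J \<subseteq> {1..n} - {i} \<and> card J = k - 1} \<subseteq> {I. I \<subseteq> {1..n} \<and> card I = k \<and> i \<in> I}"
    proof (clarsimp, intro conjI)
      fix J assume J: "J \<subseteq> {Suc 0..n} - {i}" "card J = k - Suc 0"
      then have "finite J" "i \<notin> J" using finite_subset by auto
      then show "card (insert i J) = k" using J(2) assms(1) by simp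
      show "Suc 0 \<le> i" "i \<le> n" "J \<subseteq> {Suc 0..n}" using assms(2) J(1) by auto
    qed
    show "(\<lambda>I. I - {i}) ` {I. I \<subseteq> {1..n} \<and> card I = k \<and> i \<in> I} \<subseteq> {J. J \<subseteq> {1..n} - {i} \<and> card J = k - 1}"
      by auto
  qed auto
  then have "card {I. I \<subseteq> {1..n} \<and> card I = k \<and> i \<in> I} = card {J. J \<subseteq> {1..n} - {i} \<and> card J = k - 1}"
    by (simp add: bij_betw_same_card)
  also have "\<dots> = card ({1..n} - {i}) choose (k - 1)" by (intro n_subsets) simp
  finally show ?thesis using assms(2) by simp
qed

text \<open>Double counting: each \<open>f i\<close> occurs once for every \<open>k\<close>-subset
  containing \<open>i\<close>.\<close>

lemma sum_over_subsets:
  fixes f :: "nat \<Rightarrow> real"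
  assumes "1 \<le> k"
  shows "(\<Sum>I | I \<subseteq> {1..n} \<and> card I = k. \<Sum>i\<in>I. f i) = ((n - 1) choose (k - 1)) * (\<Sum>i=1..n. f i)"
proof -
  let ?F = "{I. I \<subseteq> {1..n} \<and> card I = k}"
  have fin: "finite ?F" by (rule finite_subset[of _ "Pow {1..n}"]) auto
  have "(\<Sum>I\<in>?F. \<Sum>i\<in>I. f i) = (\<Sum>I\<in>?F. \<Sum>i=1..n. if i \<in> I then f i else 0)"
  proof (rule sum.cong[OF refl])
    fix I assume "I \<in> ?F"
    then have "{1..n} \<inter> I = I" by auto
    then show "(\<Sum>i\<in>I. f i) = (\<Sum>i=1..n. if i \<in> I then f i else 0)"
      using sum.inter_restrict[of "{1..n}" f I] by simp
  qed
  also have "\<dots> = (\<Sum>i=1..n. \<Sum>I\<in>?F. if i \<in> I then f i else 0)" by (rule sum.swap)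
  also have "\<dots> = (\<Sum>i=1..n. ((n - 1) choose (k - 1)) * f i)"
  proof (intro sum.cong refl)
    fix i assume i: "i \<in> {1..n}"
    have "(\<Sum>I\<in>?F. if i \<in> I then f i else 0) = (\<Sum>I\<in>{I \<in> ?F. i \<in> I}. f i)"
      using fin by (rule sum.inter_filter[symmetric])
    also have "{I \<in> ?F. i \<in> I} = {I. I \<subseteq> {1..n} \<and> card I = k \<and> i \<in> I}" by auto
    finally show "(\<Sum>I\<in>?F. if i \<in> I then f i else 0) = ((n - 1) choose (k - 1)) * f i"
      by (simp only: sum_constant card_subsets_containing[OF assms i])
  qed
  finally show ?thesis by (simp add: sum_distrib_left)
qed

text \<open>Since \<open>k - 1 \<le> n - 2\<close>, one set \<open>J\<close> avoiding
  \<open>i\<close> and \<open>j\<close> completes either of them to a \<open>k\<close>-subset;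
  cancelling \<open>prod x J\<close> compares \<open>x i\<close> with \<open>x j\<close>.\<close>

lemma all_equal_of_equal_subset_products:
  fixes x :: "nat \<Rightarrow> real"
  assumes "1 \<le> k" "k < n" and pos: "\<And>i. i \<in> {1..n} \<Longrightarrow> x i > 0"
    and eq: "\<And>I. I \<subseteq> {1..n} \<Longrightarrow> card I = k \<Longrightarrow> prod x I = A"
    and ij: "i \<in> {1..n}" "j \<in> {1..n}"
  shows "x i = x j"
proof (cases "i = j")
  case False
  have "card ({1..n} - {i, j}) = n - 2" using ij False by (simp add: card_Diff_subset)
  then have "k - 1 \<le> card ({1..n} - {i, j})" using assms(1,2) by simp
  then obtain J where J: "J \<subseteq> {1..n} - {i, j}" "card J = k - 1" "finite J"
    using obtain_subset_with_card_n by metis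
  have "prod x (insert t J) = A" if "t \<in> {i, j}" for t
    using J that ij assms(1) by (intro eq) (auto simp: card_insert_if)
  then have "prod x (insert i J) = prod x (insert j J)" by simp
  moreover have "i \<notin> J" "j \<notin> J" using J(1) by auto
  ultimately have "x i * prod x J = x j * prod x J" using J(3) by simp
  moreover have "prod x J > 0" using J(1) pos by (intro prod_pos) auto
  ultimately show ?thesis by simp
qed simp

section \<open>The inequality and its equality cases\<close>

theorem theorem3:
  fixes k n :: nat and x :: "nat \<Rightarrow> nat"
  assumes "1 \<le> k" and "k < n"
    and "\<And>i. i \<in> {1..n} \<Longrightarrow> x i > 0"
    and "sigma k n x = sigma n n x"
  shows "real (sigma n n x) \<ge> real (n choose k) powr (real n / real (n - k)) \<and>
    (real (sigma n n x) = real (n choose k) powr (real n / real (n - k)) \<longleftrightarrow>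
      (k = n - 1 \<and> (\<forall>i\<in>{1..n}. x i = n)) \<or>
      (k = n - 2 \<and> is_square (n choose 2) \<and>
        (\<forall>i\<in>{1..n}. real (x i) = sqrt (real (n choose 2)))))"
proof -
  define P where "P = real (sigma n n x)"
  define C where "C = real (n choose k)"
  define e where "e = real n / real (n - k)"
  let ?F = "{I. I \<subseteq> {1..n} \<and> card I = k}"
  let ?y = "\<lambda>I. \<Prod>i\<in>I. real (x i)"
  have P: "P = (\<Prod>i=1..n. real (x i))" by (simp add: P_def sigma_top)
  have P0: "P > 0" unfolding P using assms(3) by (intro prod_pos) auto
  have C0: "C > 0" using assms(2) by (simp add: C_def)
  have fin: "finite ?F" by (rule finite_subset[of _ "Pow {1..n}"]) auto
  have card: "card ?F = n choose k" using n_subsets[of "{1..n}" k] by simp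
  then have ne: "?F \<noteq> {}" using assms(2) by (metis card.empty less_imp_le zero_less_binomial less_irrefl)
  have ypos: "?y I > 0" if "I \<in> ?F" for I using that assms(3) by (intro prod_pos) auto
  \<comment> \<open>The equation between the symmetric polynomials enters here: the
    \<open>k\<close>-fold products have sum \<open>P\<close>, hence mean
    \<open>P / C\<close>.\<close>
  have sumy: "(\<Sum>I\<in>?F. ?y I) = P"
    unfolding P_def assms(4)[symmetric] by (simp add: sigma_def)
  have "(\<Sum>I\<in>?F. ln (?y I)) = (\<Sum>I\<in>?F. \<Sum>i\<in>I. ln (real (x i)))"
  proof (intro sum.cong refl ln_prod)
    fix I i assume "I \<in> ?F" "i \<in> I"
    then have "i \<in> {1..n}" by auto
    then show "real (x i) \<noteq> 0" using assms(3)[of i] by simp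
  qed (auto intro: finite_subset)
  also have "\<dots> = ((n - 1) choose (k - 1)) * (\<Sum>i=1..n. ln (real (x i)))"
    using assms(1) by (rule sum_over_subsets)
  also have "(\<Sum>i=1..n. ln (real (x i))) = ln P"
    unfolding P using assms(3) by (intro ln_prod[symmetric]) auto
  finally have sum_ln: "(\<Sum>I\<in>?F. ln (?y I)) = ((n - 1) choose (k - 1)) * ln P" .
  have kC: "real k * C = real n * real ((n - 1) choose (k - 1))"
    unfolding C_def using times_binomial_minus1_eq[of k n] assms(1) by (metis of_nat_mult less_le_trans zero_less_one)
  have sum_ln': "real n * (\<Sum>I\<in>?F. ln (?y I)) = C * (real k * ln P)"
  proof -
    have "real n * (\<Sum>I\<in>?F. ln (?y I)) = (real k * C) * ln P"
      unfolding sum_ln kC by (simp only: mult.assoc)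
    then show ?thesis by (simp only: mult.commute mult.left_commute)
  qed
  have rhs: "real n * (real (card ?F) * ln ((\<Sum>I\<in>?F. ?y I) / real (card ?F))) =
      C * (real n * (ln P - ln C))"
    unfolding card sumy C_def[symmetric] ln_divide_pos[OF P0 C0] by (simp only: mult.left_commute)
  \<comment> \<open>Up to positive factors, \<open>ln P - e * ln C\<close> is the gap in the
    inequality of the means, so this identity serves both the bound and its equality case.\<close>
  have gap: "C * ((real n - real k) * (ln P - e * ln C)) =
      real n * (real (card ?F) * ln ((\<Sum>I\<in>?F. ?y I) / real (card ?F)) - (\<Sum>I\<in>?F. ln (?y I)))"
  proof -
    have "(real n - real k) * e = real n" using assms(2) by (simp add: e_def of_nat_diff)
    then have "(real n - real k) * (e * ln C) = real n * ln C" by (metis mult.assoc)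
    then have "(real n - real k) * (ln P - e * ln C) = real n * (ln P - ln C) - real k * ln P"
      by (simp only: left_diff_distrib right_diff_distrib)
    then have "C * ((real n - real k) * (ln P - e * ln C)) =
        C * (real n * (ln P - ln C)) - C * (real k * ln P)"
      by (simp only: right_diff_distrib)
    then show ?thesis by (simp only: right_diff_distrib sum_ln' rhs)
  qed
  have nk: "real n - real k > 0" "real n > 0" using assms(2) by auto
  have "C * ((real n - real k) * (ln P - e * ln C)) \<ge> 0"
    unfolding gap using sum_ln_le_card_ln_mean(1)[OF fin ne ypos] nk by simp
  then have "ln (C powr e) \<le> ln P"
    using C0 nk by (simp add: ln_powr zero_le_mult_iff)
  then have ineq: "C powr e \<le> P" using ln_le_cancel_iff[of "C powr e" P] P0 C0 by simp
  have "(k = n - 1 \<and> (\<forall>i\<in>{1..n}. x i = n)) \<or>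
      (k = n - 2 \<and> is_square (n choose 2) \<and>
        (\<forall>i\<in>{1..n}. real (x i) = sqrt (real (n choose 2))))" if eq: "P = C powr e"
  proof -
    have "ln P = e * ln C" using C0 by (simp add: eq ln_powr)
    then have sum_eq: "(\<Sum>I\<in>?F. ln (?y I)) = real (card ?F) * ln ((\<Sum>I\<in>?F. ?y I) / real (card ?F))"
      using gap nk by simp
    have prods: "?y I = (\<Sum>I\<in>?F. ?y I) / real (card ?F)" if "I \<in> ?F" for I
      by (rule sum_ln_le_card_ln_mean(2)[where y = ?y, OF fin ne ypos sum_eq that])
    define c where "c = x 1"
    have const: "x i = c" if "i \<in> {1..n}" for i
    proof -
      have "real (x i) = real (x 1)"
      proof (rule all_equal_of_equal_subset_products[where x = "\<lambda>i. real (x i)", OF assms(1,2)])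
        show "real (x j) > 0" if "j \<in> {1..n}" for j using assms(3)[OF that] by simp
        show "?y I = (\<Sum>I\<in>?F. ?y I) / real (card ?F)" if "I \<subseteq> {1..n}" "card I = k" for I
          using that by (intro prods) simp
        show "i \<in> {1..n}" by fact
        show "1 \<in> {1..n}" using assms(2) by simp
      qed
      then show ?thesis by (simp add: c_def)
    qed
    have "sigma k n x = (\<Sum>I\<in>?F. c ^ k)"
      unfolding sigma_def
    proof (intro sum.cong refl)
      fix I assume I: "I \<in> ?F"
      then have "prod x I = (\<Prod>i\<in>I. c)" using const by (intro prod.cong) auto
      then show "prod x I = c ^ k" using I by simp
    qed
    moreover have "sigma n n x = c ^ n"
      unfolding sigma_top using const by simp
    \<comment> \<open>For constant \<open>x\<close> the equation reads
      \<open>(n choose k) * c ^ k = c ^ n\<close>; cancelling \<open>c ^ k\<close> leaves a binomial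
      coefficient that is an own power.\<close>
    ultimately have "(n choose k) * c ^ k = c ^ (n - k) * c ^ k"
      using assms(2,4) card by (simp flip: power_add)
    moreover have "c > 0" using assms(2,3) by (simp add: c_def)
    ultimately have pow: "n choose k = c ^ (n - k)" by simp
    consider "n - k = 1" | "n - k = 2" | "n - k \<ge> 3" using assms(2) by linarith
    then show ?thesis
    proof cases
      case 1
      then have "k = n - 1" by simp
      moreover have "n choose k = n" using binomial_symmetric[of k n] 1 assms(2) by simp
      ultimately show ?thesis using pow 1 const by auto
    next
      case 2
      then have "k = n - 2" by simp
      moreover have "n choose 2 = c\<^sup>2" using binomial_symmetric[of k n] pow 2 assms(2) by simp
      ultimately show ?thesis using const by auto
    next
      case 3
      \<comment> \<open>Rewriting \<open>n\<close> as \<open>k + (n - k)\<close> fits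
        \<open>binomial_ne_own_power\<close> with \<open>N = k\<close> and
        \<open>l = n - k\<close>.\<close>
      have "k + (n - k) choose (n - k) = c ^ (n - k)"
        using pow binomial_symmetric[of k n] assms(2) by simp
      then show ?thesis using binomial_ne_own_power[OF 3 assms(1)] by blast
    qed
  qed
  moreover have "P = C powr e" if "k = n - 1" "\<forall>i\<in>{1..n}. x i = n"
  proof -
    have "P = real n ^ n" unfolding P using that(2) by simp
    moreover have "n choose k = n" using binomial_symmetric[of k n] that(1) assms(2) by simp
    moreover have "n - k = 1" using that(1) assms(2) by simp
    ultimately show ?thesis using nk(2) by (simp add: C_def e_def powr_realpow)
  qed
  moreover have "P = C powr e" if "k = n - 2" "\<forall>i\<in>{1..n}. real (x i) = sqrt (real (n choose 2))"
  proof -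
    \<comment> \<open>The bound \<open>1 \<le> k\<close> ensures that the subtraction in
      \<open>k = n - 2\<close> is not truncated.\<close>
    have nk2: "n - k = 2" using that(1) assms(1,2) by simp
    then have "n choose k = n choose 2" using binomial_symmetric[of k n] assms(2) by simp
    then have "P = sqrt C ^ n" unfolding P C_def using that(2) by simp
    also have "\<dots> = (C powr (1/2)) powr real n"
      using C0 by (simp add: powr_half_sqrt powr_realpow)
    finally show ?thesis by (simp add: powr_powr e_def nk2)
  qed
  ultimately show ?thesis using ineq unfolding P_def C_def e_def by blast
qed

end
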